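(* Let $D$ be a discriminant form of type $2_{I\!I}^{\epsilon n}$ with $n$ even, and let $\gamma\in I$. Then \[\operatorname{inv}_D(e^{\gamma})=\epsilon\,\frac13\,\frac{1}{2^{(n-2)/2}}\Bigg\{\sum_{\mu\in\gamma^{\perp}\cap I}2\,e^{\mu}-\sum_{\mu\in I}e^{\mu}\Bigg\}+\frac13\,e^{\gamma}.\]
   Context: A discriminant form is a finite abelian group $D$ with a quadratic form $\operatorname{q}:D\to\mathbb Q/\mathbb Z$ whose associated bilinear form $(\beta,\gamma)=\operatorname{q}(\beta+\gamma)-\operatorname{q}(\beta)-\operatorname{q}(\gamma)$ is nondegenerate. $2_{I\!I}^{\epsilon n}$ ($n$ even) is the orthogonal sum of $n/2$ forms, each generated by $\gamma,\delta$ of order $2$ with $(\gamma,\delta)=1/2$ and $\operatorname{q}(\gamma)=\operatorname{q}(\delta)=0$ (sign $+$) or $\operatorname{q}(\gamma)=\operatorname{q}(\delta)=1/2$ (sign $-$), $\epsilon$ being the product of the signs; it has level $2$ and even signature $\operatorname{sign}(D)\in\mathbb Z/8\mathbb Z$. $e(x)=e^{2\pi ix}$, $\Gamma=\operatorname{SL}_2(\mathbb Z)$. Weil representation: $\rho_D(T)e^\gamma=e(-\operatorname{q}(\gamma))e^\gamma$, $\rho_D(S)e^\gamma=\frac{e(\operatorname{sign}(D)/8)}{\sqrt{|D|}}\sum_\beta e((\gamma,\beta))e^\beta$; $\operatorname{inv}_D(e^\gamma)=\frac{1}{|\Gamma/\Gamma(2)|}\sum_{M\in\Gamma/\Gamma(2)}\rho_D(M)e^\gamma$.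 $I$ is the set of isotropic elements, $\gamma^\perp=\{\mu:(\mu,\gamma)=0\}$. *)

theory Defs
  imports
    "HOL-Analysis.Analysis"
    "HOL-Computational_Algebra.Group_Closure"
begin

subsection \<open>The group \<open>\<rat>/\<int>\<close> and the character \<open>e\<close>\<close>

quotient_type qmodz = rat / "\<lambda>x y. x - y \<in> \<int>"
proof (rule equivpI)
  show "reflp (\<lambda>x y :: rat. x - y \<in> \<int>)"
    by (simp add: reflp_def)
  show "symp (\<lambda>x y :: rat. x - y \<in> \<int>)"
    by (metis (no_types, lifting) Ints_minus minus_diff_eq sympI)
  show "transp (\<lambda>x y :: rat. x - y \<in> \<int>)"
    by (rule transpI) (metis Ints_add add_diff_eq diff_add_cancel)
qed

instantiation qmodz :: ab_group_add
begin

lift_definition zero_qmodz :: qmodz is 0 .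

lift_definition plus_qmodz :: "qmodz \<Rightarrow> qmodz \<Rightarrow> qmodz" is "(+)"
  by (metis (no_types, lifting) Ints_add add_diff_add)

lift_definition uminus_qmodz :: "qmodz \<Rightarrow> qmodz" is uminus
  by (metis (no_types, lifting) Ints_minus minus_diff_minus)

lift_definition minus_qmodz :: "qmodz \<Rightarrow> qmodz \<Rightarrow> qmodz" is "(-)"
  by (metis (no_types, lifting) Ints_diff diff_diff_eq2 diff_add_eq add_diff_eq diff_diff_add
      add.commute)

instance
  by standard (transfer, simp add: algebra_simps)+

end

lift_definition qmodz_of_rat :: "rat \<Rightarrow> qmodz" is "\<lambda>x. x" .

definition e :: "real \<Rightarrow> complex" where
  "e x = exp (2 * of_real pi * \<i> * of_real x)"

lift_definition e_qmodz :: "qmodz \<Rightarrow> complex" is "\<lambda>x. e (of_rat x)"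
proof -
  fix x y :: rat
  assume "x - y \<in> \<int>"
  then obtain k where "x = y + of_int k"
    by (metis Ints_cases add.commute diff_add_cancel)
  then have "2 * of_real pi * \<i> * of_real (of_rat x) =
      2 * of_real pi * \<i> * of_real (of_rat y) + of_real (of_int (2 * k) * pi) * \<i>"
    by (simp add: of_rat_add algebra_simps)
  then show "e (of_rat x) = e (of_rat y)"
    unfolding e_def exp_eq by blast
qed


subsection \<open>Discriminant forms\<close>

definition int_mult :: "int \<Rightarrow> 'a::ab_group_add \<Rightarrow> 'a" where
  "int_mult k x = (if k \<ge> 0 then (\<Sum>i<nat k. x) else - (\<Sum>i<nat (- k). x))"

definition bil :: "('a::ab_group_add \<Rightarrow> qmodz) \<Rightarrow> 'a \<Rightarrow> 'a \<Rightarrow> qmodz" where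
  "bil q \<beta> \<gamma> = q (\<beta> + \<gamma>) - q \<beta> - q \<gamma>"

definition quadratic_form :: "('a::ab_group_add \<Rightarrow> qmodz) \<Rightarrow> bool" where
  "quadratic_form q \<longleftrightarrow>
    (\<forall>k \<gamma>. q (int_mult k \<gamma>) = int_mult (k\<^sup>2) (q \<gamma>)) \<and>
    (\<forall>\<alpha> \<beta> \<gamma>. bil q (\<alpha> + \<beta>) \<gamma> = bil q \<alpha> \<gamma> + bil q \<beta> \<gamma>) \<and>
    (\<forall>\<alpha> \<beta> \<gamma>. bil q \<alpha> (\<beta> + \<gamma>) = bil q \<alpha> \<beta> + bil q \<alpha> \<gamma>)"

text \<open>The underlying group of a discriminant form is the whole type \<open>'a\<close>.\<close>

definition discriminant_form :: "('a::{finite, ab_group_add} \<Rightarrow> qmodz) \<Rightarrow> bool" where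
  "discriminant_form q \<longleftrightarrow>
    quadratic_form q \<and> (\<forall>\<beta>. (\<forall>\<gamma>. bil q \<beta> \<gamma> = 0) \<longrightarrow> \<beta> = 0)"

definition isotropic :: "('a::ab_group_add \<Rightarrow> qmodz) \<Rightarrow> 'a set" where
  "isotropic q = {\<gamma>. q \<gamma> = 0}"

definition perp :: "('a::ab_group_add \<Rightarrow> qmodz) \<Rightarrow> 'a \<Rightarrow> 'a set" where
  "perp q \<gamma> = {\<mu>. bil q \<mu> \<gamma> = 0}"

text \<open>
  The signature in \<open>\<int>/8\<int>\<close>, represented by an integer in \<open>{0..<8}\<close>. It is determined by
  Milgram's formula for the Gauss sum of \<open>q\<close>.
\<close>

definition signature :: "('a::{finite, ab_group_add} \<Rightarrow> qmodz) \<Rightarrow> int" where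
  "signature q = (THE s. 0 \<le> s \<and> s < 8 \<and>
    (\<Sum>\<gamma>\<in>UNIV. e_qmodz (q \<gamma>)) = of_real (sqrt (real CARD('a))) * e (of_int s / 8))"

text \<open>
  Internal orthogonal direct sum: the subgroups \<open>H i\<close>, \<open>i < m\<close>, are pairwise orthogonal and
  every element is a sum of elements of the \<open>H i\<close> in exactly one way.
\<close>

definition orthogonal_sum ::
  "('a::ab_group_add \<Rightarrow> qmodz) \<Rightarrow> nat \<Rightarrow> (nat \<Rightarrow> 'a set) \<Rightarrow> bool" where
  "orthogonal_sum q m H \<longleftrightarrow>
    (\<forall>i<m. \<forall>j<m. i \<noteq> j \<longrightarrow> (\<forall>x\<in>H i. \<forall>y\<in>H j. bil q x y = 0)) \<and>
    (\<forall>x. \<exists>!f. f \<in> (\<Pi>\<^sub>E i\<in>{..<m}. H i) \<and> x = (\<Sum>i<m. f i))"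

text \<open>
  \<open>type_2II q \<epsilon> n\<close>: the form is of type \<open>2\<^sub>I\<^sub>I\<close> with exponent \<open>\<epsilon>n\<close>; \<open>s i\<close> is the sign of the
  \<open>i\<close>-th summand.
\<close>

definition type_2II :: "('a::{finite, ab_group_add} \<Rightarrow> qmodz) \<Rightarrow> int \<Rightarrow> nat \<Rightarrow> bool" where
  "type_2II q \<epsilon> n \<longleftrightarrow> even n \<and>
    (\<exists>(g :: nat \<Rightarrow> 'a) (d :: nat \<Rightarrow> 'a) (s :: nat \<Rightarrow> int).
      (\<forall>i < n div 2.
        g i \<noteq> 0 \<and> g i + g i = 0 \<and> d i \<noteq> 0 \<and> d i + d i = 0 \<and>
        bil q (g i) (d i) = qmodz_of_rat (1/2) \<and>
        (s i = 1 \<and> q (g i) = 0 \<and> q (d i) = 0 \<or>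
         s i = - 1 \<and> q (g i) = qmodz_of_rat (1/2) \<and> q (d i) = qmodz_of_rat (1/2))) \<and>
      orthogonal_sum q (n div 2) (\<lambda>i. group_closure {g i, d i}) \<and>
      \<epsilon> = (\<Prod>i < n div 2. s i))"


subsection \<open>The modular group\<close>

definition SL2Z :: "(int^2^2) set" where
  "SL2Z = {M. det M = 1}"

definition S_mat :: "int^2^2" where
  "S_mat = vector [vector [0, -1], vector [1, 0]]"

definition T_mat :: "int^2^2" where
  "T_mat = vector [vector [1, 1], vector [0, 1]]"

definition Gamma :: "int \<Rightarrow> (int^2^2) set" where
  "Gamma N = {M \<in> SL2Z. \<forall>i j. N dvd (M $ i $ j - mat 1 $ i $ j)}"

definition cosets :: "int \<Rightarrow> (int^2^2) set set" where
  "cosets N = (\<lambda>M. (\<lambda>K. M ** K) ` Gamma N) ` SL2Z"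


subsection \<open>The Weil representation\<close>

text \<open>
  The group algebra \<open>\<complex>[D]\<close> is \<open>complex^'a\<close>, with basis vectors \<open>e\<^sup>\<gamma>\<close>.
\<close>

type_synonym 'a group_algebra = "(complex, 'a) vec"

abbreviation basis_vec :: "'a::finite \<Rightarrow> 'a group_algebra" where
  "basis_vec \<gamma> \<equiv> axis \<gamma> 1"

definition is_weil_rep ::
  "('a::{finite, ab_group_add} \<Rightarrow> qmodz) \<Rightarrow> (int^2^2 \<Rightarrow> 'a group_algebra \<Rightarrow> 'a group_algebra) \<Rightarrow> bool" where
  "is_weil_rep q \<rho> \<longleftrightarrow>
    \<rho> \<in> extensional SL2Z \<and>
    (\<forall>M\<in>SL2Z. Vector_Spaces.linear (*s) (*s) (\<rho> M)) \<and>
    \<rho> (mat 1) = id \<and>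
    (\<forall>M\<in>SL2Z. \<forall>N\<in>SL2Z. \<rho> (M ** N) = \<rho> M \<circ> \<rho> N) \<and>
    (\<forall>\<gamma>. \<rho> T_mat (basis_vec \<gamma>) = e_qmodz (- q \<gamma>) *s basis_vec \<gamma>) \<and>
    (\<forall>\<gamma>. \<rho> S_mat (basis_vec \<gamma>) =
      (e (of_int (signature q) / 8) / of_real (sqrt (real CARD('a)))) *s
        (\<Sum>\<beta>\<in>UNIV. e_qmodz (bil q \<gamma> \<beta>) *s basis_vec \<beta>))"

text \<open>
  \<open>S\<close> and \<open>T\<close> generate \<open>SL\<^sub>2(\<int>)\<close>, so there is at most one such \<open>\<rho>\<close>; it exists if the signature is
  even.
\<close>

definition weil_rep ::
  "('a::{finite, ab_group_add} \<Rightarrow> qmodz) \<Rightarrow> int^2^2 \<Rightarrow> 'a group_algebra \<Rightarrow> 'a group_algebra" where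
  "weil_rep q = (THE \<rho>. is_weil_rep q \<rho>)"

text \<open>
  For \<open>D\<close> of level dividing \<open>2\<close> the representation is trivial on \<open>\<Gamma>(2)\<close>, so the summand does not
  depend on the chosen coset representative.
\<close>

definition inv_D ::
  "('a::{finite, ab_group_add} \<Rightarrow> qmodz) \<Rightarrow> 'a group_algebra \<Rightarrow> 'a group_algebra" where
  "inv_D q v = (1 / of_nat (card (cosets 2))) *s
    (\<Sum>C\<in>cosets 2. weil_rep q (SOME M. M \<in> C) v)"

end

theory Submission
  imports Defs
begin

text \<open>
  For a form of type \<open>2\<^sub>I\<^sub>I\<close> the Gauss sum is \<open>\<epsilon> 2\<^bsup>n/2\<^esup>\<close>, and the operators \<open>A\<close>, \<open>B\<close> prescribed for
  \<open>S\<close> and \<open>T\<close> satisfy \<open>A\<^sup>2 = B\<^sup>2 = 1\<close> and \<open>A B A = B A B\<close>. These are the defining relations of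
  \<open>SL\<^sub>2(\<int>/2) = \<Gamma>/\<Gamma>(2)\<close>, the symmetric group on three letters, so the Weil representation exists and
  factors through this quotient. If \<open>\<gamma>\<close> is isotropic then \<open>B\<close> fixes \<open>e\<^sup>\<gamma>\<close>, and the average
  over the six words in \<open>A\<close>, \<open>B\<close> becomes \<open>(e\<^sup>\<gamma> + A e\<^sup>\<gamma> + B A e\<^sup>\<gamma>) / 3\<close>. In \<open>A e\<^sup>\<gamma> + B A e\<^sup>\<gamma>\<close>
  the non-isotropic coefficients cancel, and the others are doubled with sign \<open>e((\<gamma>,\<mu>)) = \<plusminus>1\<close>.
\<close>

subsection \<open>The modular group\<close>

lemma mat2_eq_iff:
  fixes M N :: "'b^2^2"
  shows "M = N \<longleftrightarrow> M$1$1 = N$1$1 \<and> M$1$2 = N$1$2 \<and> M$2$1 = N$2$1 \<and> M$2$2 = N$2$2"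
  by (auto simp: vec_eq_iff forall_2)

lemma mat2_mult:
  fixes M N :: "'b::semiring_1^2^2"
  shows "(M ** N)$i$j = M$i$1 * N$1$j + M$i$2 * N$2$j"
  by (simp add: matrix_matrix_mult_def sum_2)

lemma mat2_one [simp]:
  "(mat 1 :: int^2^2)$1$1 = 1" "(mat 1 :: int^2^2)$1$2 = 0"
  "(mat 1 :: int^2^2)$2$1 = 0" "(mat 1 :: int^2^2)$2$2 = 1"
  by (simp_all add: mat_def)

lemma S_mat_nth [simp]: "S_mat$1$1 = 0" "S_mat$1$2 = -1" "S_mat$2$1 = 1" "S_mat$2$2 = 0"
  by (simp_all add: S_mat_def)

lemma T_mat_nth [simp]: "T_mat$1$1 = 1" "T_mat$1$2 = 1" "T_mat$2$1 = 0" "T_mat$2$2 = 1"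
  by (simp_all add: T_mat_def)

lemma SL2Z_iff: "M \<in> SL2Z \<longleftrightarrow> M$1$1 * M$2$2 - M$1$2 * M$2$1 = 1"
  by (simp add: SL2Z_def det_2)

lemma mat_1_SL2Z [simp]: "mat 1 \<in> SL2Z"
  and S_mat_SL2Z [simp]: "S_mat \<in> SL2Z"
  and T_mat_SL2Z [simp]: "T_mat \<in> SL2Z"
  by (simp_all add: SL2Z_iff)

lemma SL2Z_mult [simp]: "M \<in> SL2Z \<Longrightarrow> N \<in> SL2Z \<Longrightarrow> M ** N \<in> SL2Z"
  by (simp add: SL2Z_def det_mul)

text \<open>The adjugate serves as the inverse in determinant one and keeps the entries
  integral.\<close>

definition adj2 :: "int^2^2 \<Rightarrow> int^2^2" where
  "adj2 M = vector [vector [M$2$2, - M$1$2], vector [- M$2$1, M$1$1]]"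

lemma adj2_nth [simp]:
  "(adj2 M)$1$1 = M$2$2" "(adj2 M)$1$2 = - M$1$2"
  "(adj2 M)$2$1 = - M$2$1" "(adj2 M)$2$2 = M$1$1"
  by (simp_all add: adj2_def)

lemma adj2_SL2Z [simp]: "adj2 M \<in> SL2Z \<longleftrightarrow> M \<in> SL2Z"
  by (simp add: SL2Z_iff algebra_simps)

lemma adj2_mult: "M \<in> SL2Z \<Longrightarrow> adj2 M ** M = mat 1"
  and mult_adj2: "M \<in> SL2Z \<Longrightarrow> M ** adj2 M = mat 1"
  by (simp_all add: SL2Z_iff mat2_eq_iff mat2_mult algebra_simps)

text \<open>The Euclidean algorithm on the first column: left multiplication by \<open>S T\<^sup>k\<close> replaces the
  lower left entry \<open>c\<close> by \<open>a mod c\<close>.\<close>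

lemma SL2Z_induct [consumes 1, case_names one S T T_inv]:
  assumes "M \<in> SL2Z"
    and one: "P (mat 1)"
    and S: "\<And>N. N \<in> SL2Z \<Longrightarrow> P N \<Longrightarrow> P (S_mat ** N)"
    and T: "\<And>N. N \<in> SL2Z \<Longrightarrow> P N \<Longrightarrow> P (T_mat ** N)"
    and T_inv: "\<And>N. N \<in> SL2Z \<Longrightarrow> P N \<Longrightarrow> P (adj2 T_mat ** N)"
  shows "P M"
proof -
  define tr :: "int \<Rightarrow> int^2^2" where "tr k = vector [vector [1, k], vector [0, 1]]" for k
  have tr_nth [simp]: "(tr k)$1$1 = 1" "(tr k)$1$2 = k" "(tr k)$2$1 = 0" "(tr k)$2$2 = 1" for k
    by (simp_all add: tr_def)
  have tr_SL2Z [simp]: "tr k \<in> SL2Z" for k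
    by (simp add: SL2Z_iff)
  have tr: "P (tr k ** N)" if "N \<in> SL2Z" "P N" for k N
  proof (induction k rule: int_induct[where k = 0])
    case base
    have "tr 0 ** N = N" by (simp add: mat2_eq_iff mat2_mult)
    with that show ?case by simp
  next
    case (step1 i)
    have "tr (i + 1) ** N = T_mat ** (tr i ** N)"
      by (simp add: mat2_eq_iff mat2_mult algebra_simps)
    with step1 T[of "tr i ** N"] that show ?case by simp
  next
    case (step2 i)
    have "tr (i - 1) ** N = adj2 T_mat ** (tr i ** N)"
      by (simp add: mat2_eq_iff mat2_mult algebra_simps)
    with step2 T_inv[of "tr i ** N"] that show ?case by simp
  qed
  \<comment> \<open>\<open>S_mat ** S_mat\<close> is minus the identity; this yields the upper
    triangular matrices with diagonal -1 below.\<close>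
  have neg: "P (S_mat ** (S_mat ** N))" if "N \<in> SL2Z" "P N" for N
    using that S by simp
  from \<open>M \<in> SL2Z\<close> show ?thesis
  proof (induction "nat \<bar>M$2$1\<bar>" arbitrary: M rule: less_induct)
    case less
    show ?case
    proof (cases "M$2$1 = 0")
      case True
      with less.prems have ad: "M$1$1 * M$2$2 = 1"
        by (simp add: SL2Z_iff)
      then have "M$1$1 = 1 \<and> M$2$2 = 1 \<or> M$1$1 = -1 \<and> M$2$2 = -1"
        by (rule zmult_eq_1_iff[THEN iffD1])
      then show ?thesis
      proof
        assume "M$1$1 = 1 \<and> M$2$2 = 1"
        with True have "M = tr (M$1$2) ** mat 1"
          by (simp add: mat2_eq_iff)
        then show ?thesis using tr one by (metis mat_1_SL2Z)
      next
        assume "M$1$1 = -1 \<and> M$2$2 = -1"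
        with True have "M = S_mat ** (S_mat ** (tr (- M$1$2) ** mat 1))"
          by (simp add: mat2_eq_iff mat2_mult)
        then show ?thesis using tr neg one by (metis mat_1_SL2Z SL2Z_mult tr_SL2Z)
      qed
    next
      case False
      define k where "k = M$1$1 div M$2$1"
      define N where "N = S_mat ** (tr (- k) ** M)"
      have N: "N \<in> SL2Z" using less.prems by (simp add: N_def)
      have "N$2$1 = M$1$1 mod M$2$1"
        by (simp add: N_def mat2_mult k_def minus_div_mult_eq_mod[symmetric] algebra_simps)
      with False have "nat \<bar>N$2$1\<bar> < nat \<bar>M$2$1\<bar>"
        by (simp add: abs_mod_less)
      with less.hyps N have "P N" by blast
      \<comment> \<open>Undoing the Euclidean step needs the inverse of \<open>S_mat\<close>, which
        is its cube because its fourth power is 1.\<close>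
      then have "P (tr k ** (S_mat ** (S_mat ** (S_mat ** N))))"
        using N S neg tr by simp
      moreover have "tr k ** (S_mat ** (S_mat ** (S_mat ** N))) = M"
        by (simp add: N_def mat2_eq_iff mat2_mult algebra_simps)
      ultimately show ?thesis by simp
    qed
  qed
qed

subsection \<open>Reduction modulo 2\<close>

definition cong2 :: "int^2^2 \<Rightarrow> int^2^2 \<Rightarrow> bool" where
  "cong2 M N \<longleftrightarrow> (\<forall>i j. even (M$i$j) = even (N$i$j))"

lemma cong2_iff:
  "cong2 M N \<longleftrightarrow> even (M$1$1) = even (N$1$1) \<and> even (M$1$2) = even (N$1$2) \<and>
    even (M$2$1) = even (N$2$1) \<and> even (M$2$2) = even (N$2$2)"
  by (auto simp: cong2_def forall_2)

text \<open>\<Gamma>(2) is the kernel of reduction modulo 2, so its cosets are the fibres of that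
  reduction.\<close>

lemma coset_Gamma_2:
  assumes "M \<in> SL2Z"
  shows "(\<lambda>K. M ** K) ` Gamma 2 = {N \<in> SL2Z. cong2 N M}"
proof (intro subset_antisym subsetI)
  fix N assume "N \<in> (\<lambda>K. M ** K) ` Gamma 2"
  then show "N \<in> {N \<in> SL2Z. cong2 N M}"
    using assms by (auto simp: Gamma_def cong2_iff mat2_mult forall_2)
next
  fix N assume N: "N \<in> {N \<in> SL2Z. cong2 N M}"
  \<comment> \<open>Both diagonal entries of \<open>adj2 M ** N\<close> have the parity of this
    determinant.\<close>
  have "odd (M$1$1 * M$2$2 - M$1$2 * M$2$1)"
    using assms by (simp add: SL2Z_iff)
  with N have "adj2 M ** N \<in> Gamma 2"
    using assms by (auto simp: Gamma_def cong2_iff mat2_mult forall_2)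
  moreover have "N = M ** (adj2 M ** N)"
    using assms by (simp add: matrix_mul_assoc mult_adj2)
  ultimately show "N \<in> (\<lambda>K. M ** K) ` Gamma 2" by blast
qed

definition SL2F2_reps :: "(int^2^2) set" where
  "SL2F2_reps = {mat 1, S_mat, T_mat, S_mat ** T_mat, T_mat ** S_mat, S_mat ** (T_mat ** S_mat)}"

lemma SL2F2_reps_SL2Z: "SL2F2_reps \<subseteq> SL2Z"
  by (simp add: SL2F2_reps_def)

text \<open>Of the 16 parity patterns only six have odd determinant, and each is the pattern of one
  listed word.\<close>

lemma SL2F2_reps_complete: "M \<in> SL2Z \<Longrightarrow> \<exists>R\<in>SL2F2_reps. cong2 M R"
proof -
  assume "M \<in> SL2Z"
  then have "odd (M$1$1 * M$2$2 - M$1$2 * M$2$1)"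
    by (simp add: SL2Z_iff)
  then show ?thesis
    by (auto simp: SL2F2_reps_def cong2_iff mat2_mult)
qed

lemma SL2F2_reps_distinct: "R \<in> SL2F2_reps \<Longrightarrow> R' \<in> SL2F2_reps \<Longrightarrow> cong2 R R' \<Longrightarrow> R = R'"
  by (auto simp: SL2F2_reps_def cong2_iff mat2_mult)

lemma sum_SL2F2_reps:
  fixes f :: "int^2^2 \<Rightarrow> 'b::comm_monoid_add"
  shows "sum f SL2F2_reps = f (mat 1) + (f S_mat + (f T_mat + (f (S_mat ** T_mat) +
    (f (T_mat ** S_mat) + f (S_mat ** (T_mat ** S_mat))))))"
  unfolding SL2F2_reps_def by (simp add: mat2_eq_iff mat2_mult)

lemma card_SL2F2_reps: "card SL2F2_reps = 6"
  using sum_SL2F2_reps[of "\<lambda>_. 1::nat"] by simp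

lemma bij_betw_SL2F2_reps_cosets:
  "bij_betw (\<lambda>M. {N \<in> SL2Z. cong2 N M}) SL2F2_reps (cosets 2)"
proof (rule bij_betw_imageI)
  show "inj_on (\<lambda>M. {N \<in> SL2Z. cong2 N M}) SL2F2_reps"
  proof (rule inj_onI)
    fix R R' assume R: "R \<in> SL2F2_reps" "R' \<in> SL2F2_reps"
      and eq: "{N \<in> SL2Z. cong2 N R} = {N \<in> SL2Z. cong2 N R'}"
    have "R \<in> {N \<in> SL2Z. cong2 N R}"
      using R SL2F2_reps_SL2Z by (auto simp: cong2_def)
    with eq R show "R = R'" using SL2F2_reps_distinct by blast
  qed
  have cl: "{N \<in> SL2Z. cong2 N M} = {N \<in> SL2Z. cong2 N R}" if "cong2 M R" for M R
    using that by (auto simp: cong2_def)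
  have "cosets 2 = (\<lambda>M. {N \<in> SL2Z. cong2 N M}) ` SL2Z"
    by (auto simp: cosets_def coset_Gamma_2)
  also have "\<dots> = (\<lambda>M. {N \<in> SL2Z. cong2 N M}) ` SL2F2_reps"
  proof (intro subset_antisym image_subsetI)
    fix M assume "M \<in> SL2Z"
    then obtain R where "R \<in> SL2F2_reps" "cong2 M R"
      using SL2F2_reps_complete by blast
    with cl show "{N \<in> SL2Z. cong2 N M} \<in> (\<lambda>M. {N \<in> SL2Z. cong2 N M}) ` SL2F2_reps"
      by blast
  qed (use SL2F2_reps_SL2Z in blast)
  finally show "(\<lambda>M. {N \<in> SL2Z. cong2 N M}) ` SL2F2_reps = cosets 2" by simp
qed

lemma card_cosets_2: "card (cosets 2) = 6"
  using bij_betw_same_card[OF bij_betw_SL2F2_reps_cosets] card_SL2F2_reps by simp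

text \<open>Replaces the arbitrary representatives in \<open>inv_D\<close> by explicit words in S
  and T.\<close>

lemma sum_cosets_2:
  assumes "\<And>M N. M \<in> SL2Z \<Longrightarrow> N \<in> SL2Z \<Longrightarrow> cong2 M N \<Longrightarrow> f M = f N"
  shows "(\<Sum>C\<in>cosets 2. f (SOME M. M \<in> C)) = sum f SL2F2_reps"
proof -
  have "f (SOME M. M \<in> {N \<in> SL2Z. cong2 N R}) = f R" if "R \<in> SL2F2_reps" for R
  proof -
    have R: "R \<in> SL2Z" using that SL2F2_reps_SL2Z by blast
    then have "R \<in> {N \<in> SL2Z. cong2 N R}" by (simp add: cong2_def)
    then have "(SOME M. M \<in> {N \<in> SL2Z. cong2 N R}) \<in> {N \<in> SL2Z. cong2 N R}"
      by (rule someI)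
    with R assms show ?thesis by blast
  qed
  then show ?thesis
    by (subst sum.reindex_bij_betw[OF bij_betw_SL2F2_reps_cosets, symmetric])
      (rule sum.cong, auto)
qed

subsection \<open>The character of \<open>\<rat>/\<int>\<close>\<close>

lemma e_add: "e (x + y) = e x * e y"
  by (simp add: e_def exp_add[symmetric] algebra_simps)

lemma e_qmodz_add: "e_qmodz (x + y) = e_qmodz x * e_qmodz y"
  by transfer (simp add: of_rat_add e_add)

lemma e_qmodz_0 [simp]: "e_qmodz 0 = 1"
  by transfer (simp add: e_def)

abbreviation half :: qmodz where "half \<equiv> qmodz_of_rat (1/2)"

lemma half_add_half [simp]: "half + half = 0"
  by transfer simp

lemma uminus_half [simp]: "- half = half"
  by (simp add: minus_unique)

lemma e_half: "e (1/2) = -1"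
  by (simp add: e_def mult.commute[of _ \<i>])

lemma e_qmodz_half [simp]: "e_qmodz half = -1"
  by transfer (simp add: of_rat_divide e_half)

lemma half_neq_0 [simp]: "half \<noteq> 0"
  using e_qmodz_half e_qmodz_0 by (metis one_neq_neg_one)

text \<open>Equal values force s/8 and t/8 to differ by an integer. This is the uniqueness behind
  the definite description in \<open>signature\<close>.\<close>

lemma e_eighth_inj:
  fixes s t :: int
  assumes "0 \<le> s" "s < 8" "0 \<le> t" "t < 8" and eq: "e (of_int s / 8) = e (of_int t / 8)"
  shows "s = t"
proof -
  from eq obtain k :: int where "2 * of_real pi * \<i> * of_real (of_int s / 8) =
      2 * of_real pi * \<i> * of_real (of_int t / 8) + of_real (of_int (2 * k) * pi) * \<i>"
    unfolding e_def exp_eq by blast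
  then have "complex_of_real (2 * pi) * \<i> * of_real (of_int s / 8) =
      complex_of_real (2 * pi) * \<i> * of_real (of_int t / 8 + of_int k)"
    by (simp add: algebra_simps)
  then have "complex_of_real (of_int s / 8) = of_real (of_int t / 8 + of_int k)"
    by simp
  then have "real_of_int s / 8 = of_int t / 8 + of_int k"
    by (simp only: of_real_eq_iff)
  then have "real_of_int s = real_of_int (t + 8 * k)"
    by simp
  then have "s = t + 8 * k"
    by (simp only: of_int_eq_iff)
  with assms(1-4) show ?thesis by presburger
qed

lemma signature_eqI:
  fixes q :: "'a::{finite, ab_group_add} \<Rightarrow> qmodz"
  assumes "0 \<le> s" "s < 8"
    and "(\<Sum>\<gamma>\<in>UNIV. e_qmodz (q \<gamma>)) = of_real (sqrt (real CARD('a))) * e (of_int s / 8)"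
  shows "signature q = s"
  unfolding signature_def
proof (rule the_equality)
  fix t assume t: "0 \<le> t \<and> t < 8 \<and>
    (\<Sum>\<gamma>\<in>UNIV. e_qmodz (q \<gamma>)) = of_real (sqrt (real CARD('a))) * e (of_int t / 8)"
  have "complex_of_real (sqrt (real CARD('a))) \<noteq> 0"
    by simp
  with t assms(3) have "e (of_int t / 8) = e (of_int s / 8)"
    by (metis mult_left_cancel)
  with t assms show "t = s" by (intro e_eighth_inj) auto
qed (use assms in auto)

subsection \<open>Forms of type \<open>2\<^sub>I\<^sub>I\<close>\<close>

lemma bil_commute: "bil q \<beta> \<gamma> = bil q \<gamma> \<beta>"
  by (simp add: bil_def add.commute algebra_simps)

lemma q_add: "q (\<beta> + \<gamma>) = q \<beta> + q \<gamma> + bil q \<beta> \<gamma>"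
  by (simp add: bil_def)

lemma quadratic_form_0: "quadratic_form q \<Longrightarrow> q 0 = 0"
  unfolding quadratic_form_def by (auto simp: int_mult_def dest: spec[of _ 0])

lemma bil_add_left: "quadratic_form q \<Longrightarrow> bil q (\<alpha> + \<beta>) \<gamma> = bil q \<alpha> \<gamma> + bil q \<beta> \<gamma>"
  by (simp add: quadratic_form_def)

lemma bil_add_right: "quadratic_form q \<Longrightarrow> bil q \<alpha> (\<beta> + \<gamma>) = bil q \<alpha> \<beta> + bil q \<alpha> \<gamma>"
  by (simp add: quadratic_form_def)

lemma bil_0_left: "quadratic_form q \<Longrightarrow> bil q 0 \<gamma> = 0"
  using bil_add_left[of q 0 0 \<gamma>] by simp

lemma bil_sum_left:
  "quadratic_form q \<Longrightarrow> bil q (\<Sum>i\<in>A. f i) \<gamma> = (\<Sum>i\<in>A. bil q (f i) \<gamma>)"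
  by (induction A rule: infinite_finite_induct) (auto simp: bil_0_left bil_add_left)

lemma group_closure_pair_involutions:
  fixes g d :: "'a::ab_group_add"
  assumes "g + g = 0" "d + d = 0"
  shows "group_closure {g, d} = {0, g, d, g + d}"
proof (intro subset_antisym subsetI)
  have m: "- g = g" "- d = d" using assms by (simp_all add: minus_unique)
  have r: "g + (g + x) = x" "d + (d + x) = x" for x
    using assms by (simp_all add: add.assoc[symmetric])
  fix x assume "x \<in> group_closure {g, d}"
  then show "x \<in> {0, g, d, g + d}"
  proof induction
    case (diff s t)
    have "s - t = s + - t" by simp
    with diff show ?case
      by (auto simp: m assms r add.commute add.left_commute simp del: add_uminus_conv_diff)
  qed auto
next
  fix x assume "x \<in> {0, g, d, g + d}"
  then show "x \<in> group_closure {g, d}"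
    by (auto intro: group_closure.base group_closure_add)
qed

text \<open>Adding the components one at a time, the cross term of \<open>q\<close> vanishes at each
  step by bilinearity and pairwise orthogonality.\<close>

lemma orthogonal_sum_q:
  assumes "quadratic_form q" "orthogonal_sum q m H" "f \<in> (\<Pi>\<^sub>E i\<in>{..<m}. H i)"
  shows "q (\<Sum>i<m. f i) = (\<Sum>i<m. q (f i))"
proof -
  have "q (\<Sum>i<k. f i) = (\<Sum>i<k. q (f i))" if "k \<le> m" for k
    using that
  proof (induction k)
    case 0
    then show ?case using assms(1) by (simp add: quadratic_form_0)
  next
    case (Suc k)
    have "bil q (f i) (f k) = 0" if "i < k" for i
    proof -
      have "f i \<in> H i" "f k \<in> H k"
        using assms(3) Suc.prems that by (auto simp: PiE_iff)
      then show ?thesis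
        using assms(2) Suc.prems that unfolding orthogonal_sum_def
        by (metis Suc_le_lessD order.strict_trans less_irrefl)
    qed
    then have "bil q (\<Sum>i<k. f i) (f k) = 0"
      using assms(1) by (simp add: bil_sum_left)
    with Suc show ?case by (simp add: q_add)
  qed
  then show ?thesis by simp
qed

lemma orthogonal_sum_bij_betw:
  assumes "orthogonal_sum q m H"
  shows "bij_betw (\<lambda>f. \<Sum>i<m. f i) (\<Pi>\<^sub>E i\<in>{..<m}. H i) UNIV"
proof (rule bij_betw_imageI)
  have ex1: "\<exists>!f. f \<in> (\<Pi>\<^sub>E i\<in>{..<m}. H i) \<and> x = (\<Sum>i<m. f i)" for x
    using assms by (simp add: orthogonal_sum_def)
  show "inj_on (\<lambda>f. \<Sum>i<m. f i) (\<Pi>\<^sub>E i\<in>{..<m}. H i)"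
    using ex1 by (intro inj_onI) metis
  show "(\<lambda>f. \<Sum>i<m. f i) ` (\<Pi>\<^sub>E i\<in>{..<m}. H i) = UNIV"
    using ex1 by (metis (no_types, lifting) UNIV_eq_I image_eqI)
qed

lemma e_qmodz_sum: "e_qmodz (\<Sum>i\<in>A. f i) = (\<Prod>i\<in>A. e_qmodz (f i))"
  by (induction A rule: infinite_finite_induct) (auto simp: e_qmodz_add)

text \<open>Unique decomposition turns the sum over the group into a sum over tuples, where the
  summand is a product over the components.\<close>

lemma orthogonal_sum_Gauss:
  fixes q :: "'a::{finite, ab_group_add} \<Rightarrow> qmodz"
  assumes "quadratic_form q" "orthogonal_sum q m H"
  shows "(\<Sum>x\<in>UNIV. e_qmodz (q x)) = (\<Prod>i<m. \<Sum>x\<in>H i. e_qmodz (q x))"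
proof -
  have "(\<Sum>x\<in>UNIV. e_qmodz (q x)) = (\<Sum>f\<in>(\<Pi>\<^sub>E i\<in>{..<m}. H i). e_qmodz (q (\<Sum>i<m. f i)))"
    by (rule sum.reindex_bij_betw[OF orthogonal_sum_bij_betw[OF assms(2)], symmetric])
  also have "\<dots> = (\<Sum>f\<in>(\<Pi>\<^sub>E i\<in>{..<m}. H i). \<Prod>i<m. e_qmodz (q (f i)))"
    by (intro sum.cong refl) (simp add: orthogonal_sum_q[OF assms] e_qmodz_sum)
  also have "\<dots> = (\<Prod>i<m. \<Sum>x\<in>H i. e_qmodz (q x))"
    by (rule prod_sum_PiE[symmetric]) auto
  finally show ?thesis .
qed

lemma sum_half_values:
  assumes "\<And>i. i \<in> A \<Longrightarrow> f i \<in> {0, half}"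
  shows "(\<Sum>i\<in>A. f i) \<in> {0, half}"
  using assms
proof (induction A rule: infinite_finite_induct)
  case (insert i A)
  then have "f i \<in> {0, half}" "(\<Sum>i\<in>A. f i) \<in> {0, half}" by simp_all
  with insert.hyps show ?case by auto
qed simp_all

lemma type_2II_properties:
  fixes q :: "'a::{finite, ab_group_add} \<Rightarrow> qmodz"
  assumes quad: "quadratic_form q" and type: "type_2II q \<epsilon> n"
  shows type_2II_double: "x + x = 0"
    and type_2II_values: "q x \<in> {0, half}"
    and type_2II_sign: "\<epsilon> \<in> {1, -1}"
    and type_2II_card: "CARD('a) = 2 ^ n"
    and type_2II_Gauss: "(\<Sum>x\<in>UNIV. e_qmodz (q x)) = of_int \<epsilon> * 2 ^ (n div 2)"
proof -
  let ?m = "n div 2"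
  from type obtain g d :: "nat \<Rightarrow> 'a" and s :: "nat \<Rightarrow> int" where even: "even n"
    and g: "\<And>i. i < ?m \<Longrightarrow> g i \<noteq> 0" "\<And>i. i < ?m \<Longrightarrow> g i + g i = 0"
    and d: "\<And>i. i < ?m \<Longrightarrow> d i \<noteq> 0" "\<And>i. i < ?m \<Longrightarrow> d i + d i = 0"
    and gd: "\<And>i. i < ?m \<Longrightarrow> bil q (g i) (d i) = half"
    and s: "\<And>i. i < ?m \<Longrightarrow> s i = 1 \<and> q (g i) = 0 \<and> q (d i) = 0 \<or>
         s i = - 1 \<and> q (g i) = half \<and> q (d i) = half"
    and orth: "orthogonal_sum q ?m (\<lambda>i. group_closure {g i, d i})"
    and \<epsilon>: "\<epsilon> = (\<Prod>i < ?m. s i)"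
    unfolding type_2II_def by blast
  define H where "H = (\<lambda>i. group_closure {g i, d i})"
  note orth = orth[folded H_def]
  have H: "H i = {0, g i, d i, g i + d i}" if "i < ?m" for i
    using that g d by (simp add: H_def group_closure_pair_involutions)
  have q0: "q 0 = 0" using quad by (rule quadratic_form_0)
  \<comment> \<open>If they were equal, expanding \<open>q (g i + g i)\<close> would give
    \<open>q 0 = half\<close>, since \<open>q (g i) + q (g i)\<close> vanishes for either
    sign.\<close>
  have neq: "g i \<noteq> d i" if "i < ?m" for i
  proof
    assume "g i = d i"
    then have "q (g i + g i) = q (g i) + q (g i) + half"
      using gd[OF that] by (simp add: q_add)
    then have "half = 0"
      using g(2)[OF that] s[OF that] q0 by auto
    then show False by simp
  qed
  have neq0: "g i + d i \<noteq> 0" if "i < ?m" for i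
    using neq g d that by (metis add_left_cancel)
  have card_H: "card (H i) = 4" if "i < ?m" for i
    using H g d neq neq0 that by simp
  have q_gd: "q (g i + d i) = half" if "i < ?m" for i
    using s[OF that] gd[OF that] by (auto simp: q_add)
  \<comment> \<open>Over 0, g, d, g + d the terms are 1 + 1 + 1 - 1 for sign + and 1 - 1 - 1 - 1 for
    sign -.\<close>
  have Gauss_H: "(\<Sum>x\<in>H i. e_qmodz (q x)) = 2 * of_int (s i)" if "i < ?m" for i
    using H g d neq neq0 that s[OF that] q0 q_gd by auto
  have H_double: "x + x = 0" if "x \<in> H i" "i < ?m" for i x
    using that g[of i] d[of i] H[of i] by (auto simp: algebra_simps)
  have H_values: "q x \<in> {0, half}" if "x \<in> H i" "i < ?m" for i x
    using that H[of i] q0 q_gd[of i] s[of i] by auto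
  obtain f where f: "f \<in> (\<Pi>\<^sub>E i\<in>{..<?m}. H i)" and x: "x = (\<Sum>i<?m. f i)"
    using orth unfolding orthogonal_sum_def by blast
  have fH: "f i \<in> H i" if "i < ?m" for i using f that by auto
  have "f i + f i = 0" if "i < ?m" for i
    using fH H_double that by blast
  then show "x + x = 0"
    by (simp add: x sum.distrib[symmetric])
  show "q x \<in> {0, half}"
    unfolding x orthogonal_sum_q[OF quad orth f]
    using fH H_values by (intro sum_half_values) auto
  show "\<epsilon> \<in> {1, -1}"
  proof -
    have "\<bar>\<epsilon>\<bar> = (\<Prod>i < ?m. \<bar>s i\<bar>)" by (simp add: \<epsilon> abs_prod)
    also have "\<dots> = 1" by (intro prod.neutral ballI) (use s in fastforce)
    finally show ?thesis by auto
  qed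
  have "CARD('a) = card (\<Pi>\<^sub>E i\<in>{..<?m}. H i)"
    using bij_betw_same_card[OF orthogonal_sum_bij_betw[OF orth]] by simp
  also have "\<dots> = (\<Prod>i<?m. 4)"
    by (simp add: card_PiE card_H)
  also have "\<dots> = 2 ^ (2 * ?m)" by (simp add: power_mult)
  finally show "CARD('a) = 2 ^ n" using even by simp
  show "(\<Sum>x\<in>UNIV. e_qmodz (q x)) = of_int \<epsilon> * 2 ^ ?m"
    by (simp add: orthogonal_sum_Gauss[OF quad orth] Gauss_H \<epsilon> prod.distrib mult.commute)
qed

lemma type_2II_sqrt_card:
  fixes q :: "'a::{finite, ab_group_add} \<Rightarrow> qmodz"
  assumes "quadratic_form q" "type_2II q \<epsilon> n"
  shows "sqrt (real CARD('a)) = 2 ^ (n div 2)"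
proof -
  have "even n" using assms(2) by (simp add: type_2II_def)
  then have "real CARD('a) = (2 ^ (n div 2))\<^sup>2"
    by (simp add: type_2II_card[OF assms] power_mult[symmetric])
  then show ?thesis by (simp add: real_sqrt_unique)
qed

text \<open>Dividing the Gauss sum by the square root of the group order leaves \<epsilon>, so the
  signature is 0 for sign + and 4 for sign -.\<close>

lemma type_2II_signature:
  assumes "quadratic_form q" "type_2II q \<epsilon> n"
  shows "e (of_int (signature q) / 8) = of_int \<epsilon>"
proof -
  have "\<epsilon> = 1 \<or> \<epsilon> = -1" using type_2II_sign[OF assms] by simp
  then show ?thesis
  proof
    assume 1: "\<epsilon> = 1"
    have "signature q = 0"
      by (rule signature_eqI)
        (simp_all add: type_2II_Gauss[OF assms] type_2II_sqrt_card[OF assms] 1 e_def)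
    then show ?thesis by (simp add: 1 e_def)
  next
    assume 1: "\<epsilon> = -1"
    have "signature q = 4"
      by (rule signature_eqI)
        (simp_all add: type_2II_Gauss[OF assms] type_2II_sqrt_card[OF assms] 1 e_half)
    then show ?thesis by (simp add: 1 e_half)
  qed
qed

subsection \<open>Uniqueness of the Weil representation\<close>

lemma linear_eq_on_basis_vec:
  fixes f g :: "complex^'a::finite \<Rightarrow> complex^'a"
  assumes "Vector_Spaces.linear (*s) (*s) f" "Vector_Spaces.linear (*s) (*s) g"
    and "\<And>\<gamma>. f (basis_vec \<gamma>) = g (basis_vec \<gamma>)"
  shows "f = g"
proof
  fix v :: "complex^'a"
  interpret f: Vector_Spaces.linear "(*s)" "(*s)" f by fact
  interpret g: Vector_Spaces.linear "(*s)" "(*s)" g by fact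
  have "v = (\<Sum>\<gamma>\<in>UNIV. (v $ \<gamma>) *s basis_vec \<gamma>)"
    by (simp add: basis_expansion)
  then show "f v = g v"
    by (metis (no_types, lifting) assms(3) f.scale f.sum g.scale g.sum sum.cong)
qed

lemma is_weil_rep_unique:
  assumes \<rho>: "is_weil_rep q \<rho>" and \<rho>': "is_weil_rep q \<rho>'"
  shows "\<rho> = \<rho>'"
proof (rule extensionalityI)
  show "\<rho> \<in> extensional SL2Z" "\<rho>' \<in> extensional SL2Z"
    using assms by (simp_all add: is_weil_rep_def)
  have lin: "Vector_Spaces.linear (*s) (*s) (\<rho> M)" "Vector_Spaces.linear (*s) (*s) (\<rho>' M)"
    if "M \<in> SL2Z" for M
    using assms that by (simp_all add: is_weil_rep_def)
  have one: "\<rho> (mat 1) = id" "\<rho>' (mat 1) = id"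
    using assms by (simp_all add: is_weil_rep_def)
  have mult: "\<rho> (M ** N) = \<rho> M \<circ> \<rho> N" "\<rho>' (M ** N) = \<rho>' M \<circ> \<rho>' N"
    if "M \<in> SL2Z" "N \<in> SL2Z" for M N
    using assms that unfolding is_weil_rep_def by blast+
  have S: "\<rho> S_mat = \<rho>' S_mat"
    using assms by (intro linear_eq_on_basis_vec lin) (simp_all add: is_weil_rep_def)
  have T: "\<rho> T_mat = \<rho>' T_mat"
    using assms by (intro linear_eq_on_basis_vec lin) (simp_all add: is_weil_rep_def)
  \<comment> \<open>Agreement on T passes to its inverse by inserting the identity, factored through
    the other representation. The induction then covers all of \<open>SL2Z\<close>.\<close>
  have "\<rho> (adj2 T_mat) = \<rho> (adj2 T_mat) \<circ> (\<rho>' T_mat \<circ> \<rho>' (adj2 T_mat))"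
    by (simp add: mult[symmetric] mult_adj2 one)
  also have "\<dots> = (\<rho> (adj2 T_mat) \<circ> \<rho> T_mat) \<circ> \<rho>' (adj2 T_mat)"
    by (simp add: T comp_assoc)
  also have "\<dots> = \<rho>' (adj2 T_mat)"
    by (simp add: mult[symmetric] adj2_mult one)
  finally have T_inv: "\<rho> (adj2 T_mat) = \<rho>' (adj2 T_mat)" .
  fix M assume "M \<in> SL2Z"
  then show "\<rho> M = \<rho>' M"
    by (induction rule: SL2Z_induct) (simp_all add: one mult S T T_inv)
qed

lemma weil_rep_eqI: "is_weil_rep q \<rho> \<Longrightarrow> weil_rep q = \<rho>"
  unfolding weil_rep_def by (rule the_equality) (auto intro: is_weil_rep_unique)

subsection \<open>Existence of the Weil representation in level 2\<close>

text \<open>The reduction of \<open>M\<close> modulo 2, written as a word in the images \<open>A\<close> of \<open>S\<close> and \<open>B\<close> of \<open>T\<close>.\<close>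

definition parity_word :: "('b \<Rightarrow> 'b) \<Rightarrow> ('b \<Rightarrow> 'b) \<Rightarrow> int^2^2 \<Rightarrow> 'b \<Rightarrow> 'b" where
  "parity_word A B M =
    (if even (M$2$1) then (if even (M$1$2) then id else B)
     else if even (M$1$1) then (if even (M$2$2) then A else A \<circ> B)
     else (if even (M$2$2) then B \<circ> A else A \<circ> (B \<circ> A)))"

lemma parity_word_cong: "cong2 M N \<Longrightarrow> parity_word A B M = parity_word A B N"
  by (simp add: parity_word_def cong2_iff)

text \<open>Read as rewrite rules from left to right, the three relations reduce any product of two
  words to one of the six normal forms. Running through the parities of both factors then leaves a
  finite check.\<close>

lemma parity_word_mult:
  assumes A: "A \<circ> A = id" and B: "B \<circ> B = id" and braid: "B \<circ> (A \<circ> B) = A \<circ> (B \<circ> A)"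
    and "M \<in> SL2Z" "N \<in> SL2Z"
  shows "parity_word A B (M ** N) = parity_word A B M \<circ> parity_word A B N"
proof -
  have A': "A (A v) = v" and B': "B (B v) = v" and braid': "B (A (B v)) = A (B (A v))" for v
    using A B braid by (auto simp: fun_eq_iff)
  have "odd (M$1$1 * M$2$2 - M$1$2 * M$2$1)" "odd (N$1$1 * N$2$2 - N$1$2 * N$2$1)"
    using assms(4,5) by (simp_all add: SL2Z_iff)
  then show ?thesis
    unfolding fun_eq_iff parity_word_def mat2_mult even_add even_mult_iff even_diff
    by (cases "even (M$1$1)"; cases "even (M$1$2)"; cases "even (M$2$1)"; cases "even (M$2$2)";
        cases "even (N$1$1)"; cases "even (N$1$2)"; cases "even (N$2$1)"; cases "even (N$2$2)";
        simp add: A' B' braid')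
qed

text \<open>Collects what the argument uses of a form once its decomposition has been exploited. The
  scalar \<open>c\<close> normalises the operator of S: \<open>c_card\<close> makes that operator an
  involution, \<open>c_Gauss\<close> gives the braid relation.\<close>

locale level_2_form =
  fixes q :: "'a::{finite, ab_group_add} \<Rightarrow> qmodz" and c :: complex
  assumes quad: "quadratic_form q"
    and nondeg: "(\<And>\<gamma>. bil q \<beta> \<gamma> = 0) \<Longrightarrow> \<beta> = 0"
    and double: "x + x = (0 :: 'a)"
    and q_values: "q x \<in> {0, half}"
    and c_signature: "c = e (of_int (signature q) / 8) / of_real (sqrt (real CARD('a)))"
    and c_card: "c * c * of_nat CARD('a) = 1"
    and c_Gauss: "c * (\<Sum>x\<in>UNIV. e_qmodz (q x)) = 1"
begin

section \<open>The quadratic character and the pairing\<close>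

definition chi :: "'a \<Rightarrow> complex" where "chi x = e_qmodz (q x)"

definition pairing :: "'a \<Rightarrow> 'a \<Rightarrow> complex" where "pairing x y = e_qmodz (bil q x y)"

lemma bil_values: "bil q x y \<in> {0, half}"
  using q_values[of "x + y"] q_values[of x] q_values[of y] by (auto simp: bil_def)

lemma pairing_values: "pairing x y = (if bil q x y = 0 then 1 else -1)"
  using bil_values[of x y] by (auto simp: pairing_def)

lemma chi_values: "chi x = (if q x = 0 then 1 else -1)"
  using q_values[of x] by (auto simp: chi_def)

text \<open>Removes the minus sign in the action of T: the values of \<open>q\<close> are their own
  negatives.\<close>

lemma chi_uminus: "e_qmodz (- q x) = chi x"
  using q_values[of x] by (auto simp: chi_def)

lemma chi_square [simp]: "chi x * chi x = 1" "chi x * (chi x * z) = z"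
  by (simp_all add: chi_values)

lemma pairing_commute: "pairing x y = pairing y x"
  by (simp add: pairing_def bil_commute)

lemma pairing_add_left: "pairing (x + y) z = pairing x z * pairing y z"
  by (simp add: pairing_def bil_add_left[OF quad] e_qmodz_add)

lemma pairing_add_right: "pairing x (y + z) = pairing x y * pairing x z"
  by (simp add: pairing_def bil_add_right[OF quad] e_qmodz_add)

lemma chi_add: "chi (x + y) = chi x * chi y * pairing x y"
  by (simp add: chi_def pairing_def q_add[of q] e_qmodz_add)

lemma sum_translate: "(\<Sum>x\<in>UNIV. f (x + a)) = (\<Sum>x\<in>UNIV. f (x :: 'a))"
  by (rule sum.reindex_bij_witness[of _ "\<lambda>x. x - a" "\<lambda>x. x + a"]) auto

lemma add_eq_0_iff_eq: "x + y = 0 \<longleftrightarrow> x = (y :: 'a)"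
  using double by (metis add_right_cancel)

text \<open>Orthogonality of characters: for nonzero \<open>x\<close>, nondegeneracy gives a
  \<open>z\<close> with \<open>pairing x z = -1\<close>, and translation by \<open>z\<close> negates
  the sum.\<close>

lemma sum_pairing: "(\<Sum>y\<in>UNIV. pairing x y) = (if x = 0 then of_nat CARD('a) else 0)"
proof (cases "x = 0")
  case True
  then show ?thesis by (simp add: pairing_def bil_0_left[OF quad])
next
  case False
  then obtain z where "bil q x z \<noteq> 0" using nondeg by blast
  then have "pairing x z = -1" by (simp add: pairing_values)
  then have "(\<Sum>y\<in>UNIV. pairing x (y + z)) = - (\<Sum>y\<in>UNIV. pairing x y)"
    by (simp add: pairing_add_right sum_negf)
  then have "(\<Sum>y\<in>UNIV. pairing x y) = - (\<Sum>y\<in>UNIV. pairing x y)"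
    by (simp only: sum_translate)
  with False show ?thesis by simp
qed

text \<open>Completing the square.\<close>

lemma sum_chi_pairing: "c * (\<Sum>y\<in>UNIV. chi y * pairing x y) = chi x"
proof -
  have "(\<Sum>y\<in>UNIV. chi y * pairing x y) = (\<Sum>y\<in>UNIV. chi x * chi (y + x))"
    by (intro sum.cong refl) (simp add: chi_add pairing_commute algebra_simps)
  also have "\<dots> = chi x * (\<Sum>y\<in>UNIV. chi y)"
    by (simp add: sum_distrib_left[symmetric] sum_translate)
  finally show ?thesis using c_Gauss by (simp add: chi_def algebra_simps)
qed

section \<open>The operators of S and T and their relations\<close>

definition S_op :: "'a group_algebra \<Rightarrow> 'a group_algebra" where
  "S_op v = (\<chi> y. c * (\<Sum>x\<in>UNIV. pairing x y * v $ x))"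

definition T_op :: "'a group_algebra \<Rightarrow> 'a group_algebra" where
  "T_op v = (\<chi> y. chi y * v $ y)"

lemma linear_S_op: "Vector_Spaces.linear (*s) (*s) S_op"
  by unfold_locales
    (auto simp: S_op_def vec_eq_iff sum.distrib sum_distrib_left algebra_simps)

lemma linear_T_op: "Vector_Spaces.linear (*s) (*s) T_op"
  by unfold_locales (auto simp: T_op_def vec_eq_iff algebra_simps)

lemma S_op_basis: "S_op (basis_vec x) = c *s (\<Sum>y\<in>UNIV. pairing x y *s basis_vec y)"
  by (simp add: S_op_def vec_eq_iff axis_def if_distrib sum.delta sum.delta' cong: if_cong)

lemma T_op_basis: "T_op (basis_vec x) = chi x *s basis_vec x"
  by (simp add: T_op_def vec_eq_iff axis_def)

text \<open>Composition of kernels by exchanging the two sums; used both for the square of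
  \<open>S_op\<close> and for the braid relation.\<close>

lemma S_op_kernel:
  assumes "\<And>x. v $ x = (\<Sum>z\<in>UNIV. k z x * w $ z)"
  shows "S_op v $ y = (\<Sum>z\<in>UNIV. c * (\<Sum>x\<in>UNIV. pairing x y * k z x) * w $ z)"
proof -
  have "S_op v $ y = (\<Sum>x\<in>UNIV. \<Sum>z\<in>UNIV. c * (pairing x y * k z x) * w $ z)"
    by (simp add: S_op_def assms sum_distrib_left mult.assoc)
  also have "\<dots> = (\<Sum>z\<in>UNIV. \<Sum>x\<in>UNIV. c * (pairing x y * k z x) * w $ z)"
    by (rule sum.swap)
  finally show ?thesis
    by (simp add: sum_distrib_left sum_distrib_right)
qed

text \<open>The kernel of the square is a complete character sum at y + z. It survives only for y +
  z = 0, which means z = y because every element is its own negative.\<close>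

lemma S_op_S_op: "S_op \<circ> S_op = id"
proof
  fix v
  have "S_op (S_op v) $ y = v $ y" for y
  proof -
    have "S_op (S_op v) $ y =
        (\<Sum>z\<in>UNIV. c * (\<Sum>x\<in>UNIV. pairing x y * (c * pairing z x)) * v $ z)"
      by (rule S_op_kernel) (simp add: S_op_def sum_distrib_left algebra_simps)
    also have "\<dots> = (\<Sum>z\<in>UNIV. (c * c * (\<Sum>x\<in>UNIV. pairing (y + z) x)) * v $ z)"
      by (intro sum.cong refl)
        (simp add: pairing_add_left pairing_commute[of _ y] sum_distrib_left algebra_simps)
    also have "\<dots> = (\<Sum>z\<in>UNIV. if z = y then v $ z else 0)"
      using c_card by (intro sum.cong refl) (auto simp: sum_pairing add_eq_0_iff_eq)
    finally show ?thesis by simp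
  qed
  then show "(S_op \<circ> S_op) v = id v" by (simp add: vec_eq_iff)
qed

lemma T_op_T_op: "T_op \<circ> T_op = id"
  by (simp add: fun_eq_iff T_op_def vec_eq_iff)

text \<open>By completing the square, the kernel of STS is c chi(y + z). This splits as c chi(y)
  chi(z) times the pairing of y and z, the kernel of TST.\<close>

lemma braid_op: "T_op \<circ> (S_op \<circ> T_op) = S_op \<circ> (T_op \<circ> S_op)"
proof
  fix v
  have "S_op (T_op (S_op v)) $ y = T_op (S_op (T_op v)) $ y" for y
  proof -
    have "S_op (T_op (S_op v)) $ y =
        (\<Sum>z\<in>UNIV. c * (\<Sum>x\<in>UNIV. pairing x y * (c * chi x * pairing z x)) * v $ z)"
      by (rule S_op_kernel) (simp add: S_op_def T_op_def sum_distrib_left algebra_simps)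
    also have "\<dots> = (\<Sum>z\<in>UNIV. (c * (c * (\<Sum>x\<in>UNIV. chi x * pairing (y + z) x))) * v $ z)"
      by (intro sum.cong refl)
        (simp add: pairing_add_left pairing_commute[of _ y] sum_distrib_left algebra_simps)
    also have "\<dots> = (\<Sum>z\<in>UNIV. c * chi (y + z) * v $ z)"
      by (simp add: sum_chi_pairing)
    also have "\<dots> = T_op (S_op (T_op v)) $ y"
      by (simp add: S_op_def T_op_def sum_distrib_left chi_add pairing_commute[of _ y] algebra_simps)
    finally show ?thesis .
  qed
  then show "(T_op \<circ> (S_op \<circ> T_op)) v = (S_op \<circ> (T_op \<circ> S_op)) v"
    by (simp add: vec_eq_iff)
qed

section \<open>The Weil representation and its invariants\<close>

lemma linear_parity_word: "Vector_Spaces.linear (*s) (*s) (parity_word S_op T_op M)"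
  unfolding parity_word_def
  by (auto intro!: Vector_Spaces.linear_compose linear_S_op linear_T_op vec.linear_id)

lemma is_weil_rep_parity_word: "is_weil_rep q (restrict (parity_word S_op T_op) SL2Z)"
proof -
  have "parity_word S_op T_op (mat 1) = id" "parity_word S_op T_op S_mat = S_op"
    "parity_word S_op T_op T_mat = T_op"
    by (simp_all add: parity_word_def)
  then show ?thesis
    unfolding is_weil_rep_def c_signature[symmetric]
    by (simp add: linear_parity_word S_op_basis T_op_basis chi_uminus pairing_def
        parity_word_mult[OF S_op_S_op T_op_T_op braid_op])
qed

lemma weil_rep_eq_parity_word: "M \<in> SL2Z \<Longrightarrow> weil_rep q M = parity_word S_op T_op M"
  using weil_rep_eqI[OF is_weil_rep_parity_word] by simp

lemma inv_D_isotropic: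
  assumes "\<gamma> \<in> isotropic q"
  shows "inv_D q (basis_vec \<gamma>) =
    (2 * c / 3) *s ((\<Sum>\<mu> \<in> perp q \<gamma> \<inter> isotropic q. 2 *s basis_vec \<mu>)
        - (\<Sum>\<mu> \<in> isotropic q. basis_vec \<mu>)) + (1/3) *s basis_vec \<gamma>"
proof -
  let ?v = "basis_vec \<gamma> :: 'a group_algebra"
  have T: "T_op ?v = ?v"
    using assms by (simp add: T_op_basis chi_values isotropic_def)
  \<comment> \<open>Since T fixes the vector, the braid relation identifies STS with TS on it.
    Likewise T agrees with 1 and ST with S, so the six words give three vectors, each twice.\<close>
  have TST: "S_op (T_op (S_op ?v)) = T_op (S_op ?v)"
    using braid_op T by (metis comp_apply)
  have "(\<Sum>C\<in>cosets 2. weil_rep q (SOME M. M \<in> C) ?v) =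
      (\<Sum>M\<in>SL2F2_reps. weil_rep q M ?v)"
    by (rule sum_cosets_2[of "\<lambda>M. weil_rep q M ?v"])
      (simp add: weil_rep_eq_parity_word cong: parity_word_cong)
  also have "\<dots> = 2 *s (?v + S_op ?v + T_op (S_op ?v))"
    unfolding sum_SL2F2_reps
    by (simp add: weil_rep_eq_parity_word parity_word_def mat2_mult T TST vec_eq_iff)
  finally have inv: "inv_D q ?v = (1/3) *s (?v + S_op ?v + T_op (S_op ?v))"
    by (simp add: inv_D_def card_cosets_2 vec_eq_iff)
  have sums: "(\<Sum>\<mu>\<in>A. a *s basis_vec \<mu>) $ y = (if y \<in> A then a else 0)"
    for A :: "'a set" and a :: complex and y
    by (simp add: axis_def if_distrib sum.delta cong: if_cong)
  \<comment> \<open>On isotropic \<open>y\<close>, twice the indicator of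
    \<open>perp q \<gamma>\<close> minus 1 is exactly \<open>pairing \<gamma> y\<close>; elsewhere
    \<open>chi y = -1\<close> cancels the left side. The factor \<open>1 *s\<close> lets
    \<open>sums\<close> apply to the second sum.\<close>
  have "S_op ?v $ y + T_op (S_op ?v) $ y = 2 * c *
      ((\<Sum>\<mu> \<in> perp q \<gamma> \<inter> isotropic q. 2 *s basis_vec \<mu>) $ y
        - (\<Sum>\<mu> \<in> isotropic q. 1 *s basis_vec \<mu>) $ y)" for y
  proof -
    have "S_op ?v $ y = c * pairing \<gamma> y"
      by (simp add: S_op_def axis_def if_distrib sum.delta cong: if_cong)
    moreover have "T_op (S_op ?v) $ y = chi y * (S_op ?v $ y)"
      by (simp add: T_op_def)
    ultimately show ?thesis
      unfolding sums
      by (auto simp: chi_values pairing_values perp_def isotropic_def bil_commute[of q \<gamma> y])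
  qed
  then show ?thesis
    by (simp add: inv vec_eq_iff algebra_simps)
qed

end

section \<open>Application to forms of type 2_II\<close>

lemma type_2II_level_2_form:
  assumes "discriminant_form q" "type_2II q \<epsilon> n"
  shows "level_2_form q (of_int \<epsilon> / 2 ^ (n div 2))"
proof
  show quad: "quadratic_form q"
    using assms(1) by (simp add: discriminant_form_def)
  \<comment> \<open>With group order 2^n and Gauss sum \<epsilon> 2^(n/2), both normalisations of
    the scalar reduce to this.\<close>
  have sq: "of_int \<epsilon> * of_int \<epsilon> = (1 :: complex)"
    using type_2II_sign[OF quad assms(2)] by auto
  have "even n" using assms(2) by (simp add: type_2II_def)
  then have pow: "(2 :: complex) ^ n = 2 ^ (n div 2) * 2 ^ (n div 2)"
    by (metis even_two_times_div_two mult_2 power_add)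
  fix \<beta> x :: 'a
  show "\<beta> = 0" if "\<And>\<gamma>. bil q \<beta> \<gamma> = 0"
    using assms(1) that by (simp add: discriminant_form_def)
  show "x + x = 0" "q x \<in> {0, half}"
    by (rule type_2II_double[OF quad assms(2)] type_2II_values[OF quad assms(2)])+
  show "of_int \<epsilon> / 2 ^ (n div 2) =
      e (of_int (signature q) / 8) / of_real (sqrt (real CARD('a)))"
    by (simp add: type_2II_signature[OF quad assms(2)] type_2II_sqrt_card[OF quad assms(2)])
  show "of_int \<epsilon> / 2 ^ (n div 2) * (of_int \<epsilon> / 2 ^ (n div 2)) * of_nat CARD('a) = (1 :: complex)"
    using sq by (simp add: type_2II_card[OF quad assms(2)] pow)
  show "of_int \<epsilon> / 2 ^ (n div 2) * (\<Sum>x\<in>UNIV. e_qmodz (q x)) = 1"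
    using sq by (simp add: type_2II_Gauss[OF quad assms(2)])
qed

theorem theorem4p2:
  fixes q :: "'a::{finite, ab_group_add} \<Rightarrow> qmodz"
    and \<epsilon> :: int and n :: nat and \<gamma> :: 'a
  assumes "discriminant_form q"
    and "even n"
    and "type_2II q \<epsilon> n"
    and "\<gamma> \<in> isotropic q"
  shows "inv_D q (basis_vec \<gamma>) =
    (of_int \<epsilon> * (1/3) * (1 / 2 powi ((int n - 2) div 2))) *s
      ((\<Sum>\<mu> \<in> perp q \<gamma> \<inter> isotropic q. 2 *s basis_vec \<mu>)
        - (\<Sum>\<mu> \<in> isotropic q. basis_vec \<mu>))
    + (1/3) *s basis_vec \<gamma>"
proof -
  interpret level_2_form q "of_int \<epsilon> / 2 ^ (n div 2)"
    using assms by (intro type_2II_level_2_form)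
  \<comment> \<open>The exponent is -1 when \<open>n = 0\<close>, hence the integer power. The shift
    by one absorbs the 2 in \<open>2 * c / 3\<close>.\<close>
  have "(int n - 2) div 2 = int (n div 2) - 1"
    by (simp add: zdiv_int)
  then have "(2 :: complex) powi ((int n - 2) div 2) = 2 ^ (n div 2) / 2"
    by (simp add: power_int_diff)
  then have "2 * (of_int \<epsilon> / 2 ^ (n div 2)) / 3 =
      (of_int \<epsilon> * (1/3) * (1 / 2 powi ((int n - 2) div 2)) :: complex)"
    by (simp only:) (simp add: mult.commute)
  then show ?thesis
    using inv_D_isotropic[OF assms(4)] by (simp only:)
qed

end
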